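(* Let $a,b$ be positive integers whose greatest common divisor is $1$, let $\mathrm{Im}\,\tau>0$ and $q=e^{2\pi i\tau}$. Consider the function \[ \Gamma(z,a\tau,b\tau)=\prod_{j=0}^\infty\left(\frac{1-q^{j+a+b}e^{-2\pi iz}}{1-q^je^{2\pi iz}}\right)^{N_{a,b}(j)}, \] where $N_{a,b}(j)$ denotes the number of ways $j$ can be written as $j=ar+bs$ with $r,s$ nonnegative integers. Then \[ \Gamma(z,a\tau,b\tau)^{ab}=\Gamma(z,\tau,\tau)\prod_{k=0}^{ab-1}\theta_0(z+k\tau,ab\tau)^{\alpha_k}, \] where $\alpha_k=-ab+k+1$ if $k=ar+bs$ for some integers $r,s\ge0$, and $\alpha_k=k+1$ if $k$ cannot be represented in this form.
   Context: For $\mathrm{Im}\,\tau,\mathrm{Im}\,\sigma>0$, \[ \Gamma(z,\tau,\sigma)=\prod_{j,k=0}^\infty\frac{1-e^{2\pi i((j+1)\tau+(k+1)\sigma-z)}}{1-e^{2\pi i(j\tau+k\sigma+z)}},\qquad \theta_0(z,\tau)=\prod_{j=0}^\infty(1-e^{2\pi i((j+1)\tau-z)})(1-e^{2\pi i(j\tau+z)}). \] *)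

theory Defs
  imports "HOL-Complex_Analysis.Complex_Analysis"
begin

text \<open>
  The double product is rendered as an iterated infinite product. For
  \<open>Im \<tau> > 0\<close> and \<open>Im \<sigma> > 0\<close> it converges
  absolutely, so the order is immaterial. At the points of
  \<open>elliptic_gamma_poles\<close> the value of \<open>elliptic_gamma\<close> is an artefact of
  \<open>x / 0 = 0\<close> and carries no meaning.
\<close>

definition elliptic_gamma :: "complex \<Rightarrow> complex \<Rightarrow> complex \<Rightarrow> complex" where
  "elliptic_gamma z \<tau> \<sigma> =
     (\<Prod>j. \<Prod>k.
        (1 - exp (2 * of_real pi * \<i> * ((of_nat j + 1) * \<tau> + (of_nat k + 1) * \<sigma> - z))) /
        (1 - exp (2 * of_real pi * \<i> * (of_nat j * \<tau> + of_nat k * \<sigma> + z))))"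

text \<open>The points at which some denominator of the product vanishes. For
  \<open>Im \<tau> > 0\<close> and \<open>Im \<sigma> > 0\<close> these are genuine poles: a vanishing numerator
  needs \<open>Im z > 0\<close>, a vanishing denominator \<open>Im z \<le> 0\<close>.\<close>

definition elliptic_gamma_poles :: "complex \<Rightarrow> complex \<Rightarrow> complex set" where
  "elliptic_gamma_poles \<tau> \<sigma> =
     {z. \<exists>j k :: nat. 1 - exp (2 * of_real pi * \<i> * (of_nat j * \<tau> + of_nat k * \<sigma> + z)) = 0}"

definition theta0 :: "complex \<Rightarrow> complex \<Rightarrow> complex" where
  "theta0 z \<tau> =
     (\<Prod>j. (1 - exp (2 * of_real pi * \<i> * ((of_nat j + 1) * \<tau> - z))) *
          (1 - exp (2 * of_real pi * \<i> * (of_nat j * \<tau> + z))))"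

definition num_reps :: "nat \<Rightarrow> nat \<Rightarrow> nat \<Rightarrow> nat" where
  "num_reps a b j = card {(r, s). j = a * r + b * s}"

definition theta_exponent :: "nat \<Rightarrow> nat \<Rightarrow> nat \<Rightarrow> int" where
  "theta_exponent a b k =
     (if \<exists>r s :: nat. k = a * r + b * s then - int (a * b) + int k + 1 else int k + 1)"

end

theory Submission
  imports Defs
begin

text \<open>
  Put \<open>q = exp (2 \<pi> i \<tau>)\<close>, \<open>x = exp (2 \<pi> i z)\<close> and \<open>K = a b\<close>. Every function in the identity is built
  from products \<open>P(w, y) = \<Prod>n. (1 - q^n y)^w(n)\<close> with a weight \<open>w\<close> of natural numbers
  and \<open>y = x\<close> or \<open>y = q/x\<close>. If \<open>N(n)\<close> is the number of representations \<open>n = a r + b s\<close>, then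
  grouping the factors of the double product by the value of \<open>a j + b k\<close> gives
  \<open>\<Gamma>(z, a \<tau>, b \<tau>) = P(N, q^(a+b)/x) / P(N, x)\<close>; in particular
  \<open>\<Gamma>(z, \<tau>, \<tau>) = P(n + 1, q^2/x) / P(n + 1, x)\<close>. Likewise \<open>\<theta>\<^sub>0(z + k \<tau>, K \<tau>)\<close> is
  \<open>P(B\<^sub>k, q/x) P(A\<^sub>k, x)\<close>, where \<open>A\<^sub>k\<close> and \<open>B\<^sub>k\<close> are the indicators of the residue classes of
  \<open>k\<close> and \<open>K - 1 - k\<close> modulo \<open>K\<close>. The grouping is \<open>has_prod_wprod_regroup\<close>.

  Since \<open>P\<close> turns sums of weights into products, the identity reduces to two pointwise identities
  of weights, one for each of \<open>y = x\<close> and \<open>y = q/x\<close>: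
  \<open>K N(n) + \<alpha>\<^sub>k = n + 1\<close> for \<open>k = n mod K\<close> (\<open>num_reps_plus_theta_exponent\<close>), and
  \<open>K N(n + 1 - a - b) = n + \<alpha>\<^sub>k\<close> for \<open>k = K - 1 - n mod K\<close>, where \<open>N\<close> vanishes at negative
  arguments (\<open>num_reps_shifted_eq_theta_exponent\<close>). Both follow from one formula:
  if \<open>n = a r + b s\<close> with integers \<open>r, s\<close> and \<open>0 \<le> r < b\<close>, then the representations of \<open>n\<close> are
  \<open>(r + b i, s - a i)\<close> with \<open>0 \<le> i \<le> s/a\<close>, so that \<open>N(n) = max 0 (\<lfloor>s/a\<rfloor> + 1)\<close>.

  In the comparison of products the theta factors with \<open>\<alpha>\<^sub>k < 0\<close> are moved to the other side, so that
  only natural exponents occur and zeros of numerators do no harm. For the identity of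
  meromorphic functions it suffices that around each point there is a punctured neighbourhood in
  which no factor \<open>1 - q^n x\<close> or \<open>1 - q^(n+1)/x\<close> vanishes.
\<close>

section \<open>Counting representations\<close>

lemma coprime_int_representation:
  fixes n :: int
  assumes "coprime a b" "b > 0"
  obtains r s where "0 \<le> r" "r < int b" "n = int a * r + int b * s"
proof -
  obtain u v where uv: "u * int a + v * int b = 1"
    using bezout_int[of "int a" "int b"] assms(1) by auto
  define r where "r = (n * u) mod int b"
  have "n - int a * r = int b * (v * n + int a * ((n * u) div int b))"
  proof -
    have r: "r = n * u - int b * ((n * u) div int b)"
      by (simp add: r_def minus_mult_div_eq_mod)
    have "n = n * (u * int a + v * int b)" by (simp add: uv)
    then show ?thesis unfolding r by (simp add: algebra_simps)
  qed
  then show thesis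
    using assms(2) by (intro that[of r "v * n + int a * ((n * u) div int b)"]) (auto simp: r_def)
qed

text \<open>Any representation by natural numbers arises from the one with \<open>0 \<le> r < b\<close> by moving
  multiples of \<open>a b\<close> from the second summand to the first.\<close>

lemma representation_reduced:
  fixes r s :: int
  assumes "coprime a b" "a > 0" "b > 0" "0 \<le> r" "r < int b"
    and "int a * int x + int b * int y = int a * r + int b * s"
  obtains i :: nat where "int x = r + int b * int i" "int y = s - int a * int i"
proof -
  have eq: "int a * (int x - r) = int b * (s - int y)"
    using assms(6) by (simp add: algebra_simps)
  then have "int b dvd int a * (int x - r)" by simp
  then have "int b dvd int x - r"
    using assms(1) by (simp add: coprime_commute coprime_dvd_mult_right_iff)
  then obtain i where i: "int x - r = int b * i" by (elim dvdE)
  have "int b * i > - int b"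
    using i assms(5) by linarith
  then have "int b * (i + 1) > 0" by (simp add: algebra_simps)
  then have "i \<ge> 0"
    using assms(3) by (simp add: zero_less_mult_iff)
  moreover have "int b * (int a * i) = int b * (s - int y)"
    using eq i by (simp add: algebra_simps)
  then have "int a * i = s - int y"
    using assms(3) by simp
  ultimately show thesis
    using i by (intro that[of "nat i"]) auto
qed

lemma num_reps_eq:
  fixes r s :: int
  assumes "coprime a b" "a > 0" "b > 0" "0 \<le> r" "r < int b"
    and n: "int n = int a * r + int b * s"
  shows "num_reps a b n = nat (s div int a + 1)"
proof -
  let ?I = "{..<nat (s div int a + 1)}"
  let ?f = "\<lambda>i. (nat (r + int b * int i), nat (s - int a * int i))"
  have mem: "i \<in> ?I \<longleftrightarrow> int a * int i \<le> s" for i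
  proof -
    have s: "s = int a * (s div int a) + s mod int a" by simp
    have "i \<in> ?I \<longleftrightarrow> int i \<le> s div int a" by auto
    also have "\<dots> \<longleftrightarrow> int a * int i \<le> s"
    proof
      assume "int i \<le> s div int a"
      then have "int a * int i \<le> int a * (s div int a)" by (intro mult_left_mono) auto
      moreover have "0 \<le> s mod int a" using assms(2) by simp
      ultimately show "int a * int i \<le> s" using s by linarith
    next
      assume "int a * int i \<le> s"
      then have "int a * int i div int a \<le> s div int a"
        using assms(2) by (intro zdiv_mono1) auto
      then show "int i \<le> s div int a" using assms(2) by simp
    qed
    finally show ?thesis .
  qed
  have "{(r, s). n = a * r + b * s} = ?f ` ?I"
  proof (intro set_eqI iffI)
    fix p assume "p \<in> {(r, s). n = a * r + b * s}"
    then obtain x y where p: "p = (x, y)" and xy: "n = a * x + b * y" by auto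
    then have "int a * int x + int b * int y = int a * r + int b * s"
      using n by simp
    then obtain i :: nat where i: "int x = r + int b * int i" "int y = s - int a * int i"
      using representation_reduced[OF assms(1-5)] by blast
    then have "i \<in> ?I" unfolding mem by linarith
    moreover have "p = ?f i" by (simp add: p i[symmetric])
    ultimately show "p \<in> ?f ` ?I" by blast
  next
    fix p assume "p \<in> ?f ` ?I"
    then obtain i where i: "i \<in> ?I" "p = ?f i" by blast
    have "int a * (r + int b * int i) + int b * (s - int a * int i) = int n"
      by (simp add: n algebra_simps)
    moreover have "0 \<le> s - int a * int i" "0 \<le> r + int b * int i"
      using i(1) assms(4) unfolding mem by auto
    ultimately have "int (a * nat (r + int b * int i) + b * nat (s - int a * int i)) = int n"
      by simp
    then show "p \<in> {(r, s). n = a * r + b * s}"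
      unfolding i(2) of_nat_eq_iff by simp
  qed
  moreover have "inj_on ?f ?I"
  proof (rule inj_onI)
    fix i j assume "?f i = ?f j"
    then have "nat (r + int b * int i) = nat (r + int b * int j)" by simp
    then have "int b * int i = int b * int j"
      using assms(4) by (simp add: nat_eq_iff split: if_splits)
    then show "i = j" using assms(3) by simp
  qed
  ultimately show ?thesis
    unfolding num_reps_def by (simp add: card_image)
qed

lemma representable_iff:
  fixes r s :: int
  assumes "coprime a b" "a > 0" "b > 0" "0 \<le> r" "r < int b"
    and n: "int n = int a * r + int b * s"
  shows "(\<exists>x y. n = a * x + b * y) \<longleftrightarrow> s \<ge> 0"
proof
  assume "\<exists>x y. n = a * x + b * y"
  then obtain x y where xy: "n = a * x + b * y" by blast
  then have "int a * int x + int b * int y = int a * r + int b * s"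
    using n by simp
  then obtain i :: nat where "int y = s - int a * int i"
    using representation_reduced[OF assms(1-5)] by blast
  moreover have "int a * int i \<ge> 0" by simp
  ultimately show "s \<ge> 0" by linarith
next
  assume "s \<ge> 0"
  then have "int n = int (a * nat r + b * nat s)"
    using assms(4) n by simp
  then show "\<exists>x y. n = a * x + b * y"
    unfolding of_nat_eq_iff by blast
qed

lemma num_reps_le: 
  assumes "a > 0" "b > 0" 
  shows "num_reps a b n \<le> Suc n"
proof -
  have "num_reps a b n \<le> card {..n}"
    unfolding num_reps_def
  proof (rule card_inj_on_le[where f = fst])
    show "inj_on fst {(r, s). n = a * r + b * s}"
      using assms by (auto simp: inj_on_def)
    show "fst ` {(r, s). n = a * r + b * s} \<subseteq> {..n}"
    proof clarsimp
      fix r s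
      have "r \<le> a * r" using assms(1) by simp
      then show "r \<le> a * r + b * s" by (rule trans_le_add1)
    qed
  qed simp
  then show ?thesis by simp
qed

text \<open>For \<open>k < a b\<close> the reduced representation has \<open>-a < s < a\<close>; hence \<open>k\<close> has exactly one
  representation if \<open>s \<ge> 0\<close> and none otherwise.\<close>

lemma residue_representation:
  assumes "coprime a b" "a > 0" "b > 0" "k < a * b"
  obtains r s :: int where "0 \<le> r" "r < int b" "int k = int a * r + int b * s"
    "- int a < s" "s < int a"
    "theta_exponent a b k = int k + 1 - (if s \<ge> 0 then int (a * b) else 0)"
proof -
  obtain r s where rs: "0 \<le> r" "r < int b" "int k = int a * r + int b * s"
    using coprime_int_representation[OF assms(1,3)] .
  have "int b * s \<le> int k" using rs by simp
  also have "int k < int (a * b)" using assms(4) by linarith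
  finally have "int b * s < int b * int a" by (simp add: mult.commute)
  then have 1: "s < int a" using assms(3) by simp
  have "int a * r < int a * int b" using rs assms(2) by simp
  then have "int b * (- int a) < int b * s"
    using rs(3) by (simp add: algebra_simps)
  then have 2: "- int a < s" using assms(3) by (simp only: mult_less_cancel_left_pos of_nat_0_less_iff)
  show thesis
    using representable_iff[OF assms(1-3) rs] 
    by (intro that[OF rs 2 1]) (auto simp: theta_exponent_def)
qed

text \<open>The multiplicity of the factor \<open>1 - q^n x\<close> on the two sides of the identity.\<close>

lemma num_reps_plus_theta_exponent:
  assumes "coprime a b" "a > 0" "b > 0"
  shows "int (a * b) * int (num_reps a b n) + theta_exponent a b (n mod (a * b)) = int n + 1"
proof -
  define d where "d = n div (a * b)"
  define k where "k = n mod (a * b)"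
  have n: "n = a * b * d + k" by (simp add: d_def k_def)
  have "k < a * b" using assms by (simp add: k_def)
  then obtain r s :: int where rs: "0 \<le> r" "r < int b" "int k = int a * r + int b * s"
    "- int a < s" "s < int a"
    and \<alpha>: "theta_exponent a b k = int k + 1 - (if s \<ge> 0 then int (a * b) else 0)"
    using residue_representation[OF assms] by metis
  have "int n = int a * r + int b * (s + int a * int d)"
    by (simp add: n rs(3) algebra_simps)
  then have "num_reps a b n = nat ((s + int a * int d) div int a + 1)"
    by (rule num_reps_eq[OF assms rs(1,2)])
  also have "(s + int a * int d) div int a = int d + s div int a"
    using assms(2) by simp
  also have "s div int a = (if s \<ge> 0 then 0 else - 1)"
    using rs(4,5) assms(2) by (auto intro: int_div_pos_eq[where r = "s + int a"])
  finally have "int (num_reps a b n) = int d + (if s \<ge> 0 then 1 else 0)"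
    by auto
  then show ?thesis
    unfolding k_def[symmetric] \<alpha> by (simp add: n algebra_simps)
qed

text \<open>The multiplicity of the factor \<open>1 - q^(n+1)/x\<close> on the two sides of the identity. The
  reason behind the formula is the duality of Sylvester: exactly one of \<open>k\<close> and
  \<open>a b - a - b - k\<close> is representable. In reduced form, \<open>k = a r + b s\<close> corresponds to
  \<open>a b - a - b - k = a (b - 1 - r) + b (- 1 - s)\<close>.\<close>

lemma num_reps_shifted_eq_theta_exponent:
  assumes "coprime a b" "a > 0" "b > 0"
  defines "k \<equiv> \<lambda>n. a * b - 1 - n mod (a * b)"
  shows "int (a * b) * int (if n + 1 < a + b then 0 else num_reps a b (n + 1 - (a + b)))
           = int n + theta_exponent a b (k n)"
proof -
  define d where "d = n div (a * b)"
  have ab: "a * b > 0" using assms by simp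
  then have lt: "n mod (a * b) < a * b" by simp
  have n: "n = a * b * d + n mod (a * b)" by (simp add: d_def)
  have k: "int (k n) = int (a * b) - 1 - int (n mod (a * b))"
    using lt by (simp add: k_def)
  have nk: "int n = int (a * b) * int d + int (a * b) - 1 - int (k n)"
    by (subst n) (simp add: k)
  have "k n < a * b" using ab by (simp add: k_def)
  then obtain r s :: int where rs: "0 \<le> r" "r < int b" "int (k n) = int a * r + int b * s"
    "- int a < s" "s < int a"
    and \<alpha>: "theta_exponent a b (k n) = int (k n) + 1 - (if s \<ge> 0 then int (a * b) else 0)"
    using residue_representation[OF assms(1-3)] by metis
  have eq: "int n + 1 - int (a + b) = int a * (int b - 1 - r) + int b * (int a * int d - 1 - s)"
    by (simp add: nk rs(3) algebra_simps)
  have "int (if n + 1 < a + b then 0 else num_reps a b (n + 1 - (a + b))) = int d + (if s \<ge> 0 then 0 else 1)"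
  proof (cases "n + 1 < a + b")
    case True
    have "int a * (int b - 1 - r) \<ge> 0" using rs(2) by simp
    moreover have "int n + 1 - int (a + b) < 0" using True by simp
    ultimately have "int b * (int a * int d - 1 - s) < 0" using eq by linarith
    then have *: "int a * int d \<le> s" using assms(3) by (simp add: mult_less_0_iff)
    have "d = 0"
    proof (rule ccontr)
      assume "d \<noteq> 0"
      then have "int a * 1 \<le> int a * int d" by (intro mult_left_mono) auto
      then show False using * rs(5) by simp
    qed
    then show ?thesis using True * by simp
  next
    case False
    then have "int (n + 1 - (a + b)) = int a * (int b - 1 - r) + int b * (int a * int d - 1 - s)"
      using eq by simp
    then have "num_reps a b (n + 1 - (a + b)) = nat ((int a * int d - 1 - s) div int a + 1)"
      by (rule num_reps_eq[OF assms(1-3), rotated 2]) (use rs in auto)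
    also have "int a * int d - 1 - s = (- 1 - s) + int a * int d" by simp
    also have "\<dots> div int a = int d + (- 1 - s) div int a"
      using assms(2) by simp
    also have "(- 1 - s) div int a = (if s \<ge> 0 then - 1 else 0)"
      using rs(4,5) assms(2) by (auto intro: int_div_pos_eq[where r = "int a - 1 - s"] int_div_pos_eq[where r = "- 1 - s"])
    finally show ?thesis using False by auto
  qed
  then show ?thesis
    unfolding \<alpha> nk by (simp add: algebra_simps)
qed

section \<open>Weighted products of the factors 1 - q^n y\<close>

lemma norm_prod_minus_1_le_exp_sum:
  fixes f :: "nat \<Rightarrow> complex"
  assumes "\<And>i. i \<in> A \<Longrightarrow> norm (f i - 1) \<le> exp (s i) - 1"
  shows "norm (prod f A - 1) \<le> exp (sum s A) - 1"
proof (cases "finite A")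
  case True
  have "norm (prod f A - 1) = norm ((\<Prod>i\<in>A. 1 + (f i - 1)) - 1)"
    by simp
  also have "\<dots> \<le> (\<Prod>i\<in>A. 1 + norm (f i - 1)) - 1"
    by (rule norm_prod_minus1_le_prod_minus1)
  also have "(\<Prod>i\<in>A. 1 + norm (f i - 1)) \<le> (\<Prod>i\<in>A. exp (s i))"
    by (intro prod_mono) (use assms in \<open>force intro: add_nonneg_nonneg\<close>)
  also have "(\<Prod>i\<in>A. exp (s i)) = exp (sum s A)"
    by (simp add: exp_sum True)
  finally show ?thesis by simp
qed simp

lemma norm_one_minus_power_minus_1_le:
  fixes u :: complex
  shows "norm ((1 - u) ^ m - 1) \<le> exp (real m * norm u) - 1"
proof -
  have "norm ((\<Prod>i<m. 1 - u) - 1) \<le> exp (\<Sum>i<m. norm u) - 1"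
  proof (rule norm_prod_minus_1_le_exp_sum)
    show "norm (1 - u - 1) \<le> exp (norm u) - 1"
      using exp_ge_add_one_self[of "norm u"] by (auto simp del: exp_ge_add_one_self)
  qed
  then show ?thesis by simp
qed

lemma convergent_prod_if_norm_le_exp:
  fixes f :: "nat \<Rightarrow> complex"
  assumes "summable s" and "\<And>n. s n \<ge> 0" and "\<And>n. norm (f n - 1) \<le> exp (s n) - 1"
  shows "convergent_prod f"
proof -
  have "s \<longlonglongrightarrow> 0"
    by (rule summable_LIMSEQ_zero) fact
  then have "eventually (\<lambda>n. s n < 1) sequentially"
    by (rule order_tendstoD) simp
  moreover have "norm (norm (f n - 1)) \<le> 2 * s n" if "s n < 1" for n
  proof -
    have "exp (s n) \<le> 1 + s n + (s n)\<^sup>2"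
      using assms(2) that by (intro exp_bound) auto
    moreover have "(s n)\<^sup>2 \<le> s n"
      using assms(2)[of n] that by (simp add: power2_eq_square mult_left_le_one_le)
    ultimately show ?thesis
      using assms(3)[of n] by simp
  qed
  ultimately have "eventually (\<lambda>n. norm (norm (f n - 1)) \<le> 2 * s n) sequentially"
    by (auto elim: eventually_mono)
  then have "summable (\<lambda>n. norm (f n - 1))"
    by (rule summable_comparison_test_ev) (intro summable_mult assms)
  then show ?thesis
    by (intro abs_convergent_prod_imp_convergent_prod summable_imp_abs_convergent_prod)
qed

text \<open>The product \<open>\<Prod>n. (1 - q^n y)^w(n)\<close> with multiplicities \<open>w\<close>.\<close>

definition wprod :: "complex \<Rightarrow> (nat \<Rightarrow> nat) \<Rightarrow> complex \<Rightarrow> complex" where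
  "wprod q w y = (\<Prod>n. (1 - q ^ n * y) ^ w n)"

text \<open>Weights for which \<open>wprod q w y\<close> converges absolutely for every \<open>y\<close>.\<close>

definition admissible :: "complex \<Rightarrow> (nat \<Rightarrow> nat) \<Rightarrow> bool" where
  "admissible q w \<longleftrightarrow> summable (\<lambda>n. real (w n) * norm q ^ n)"

lemma admissible_le:
  assumes "admissible q v" and "\<And>n. w n \<le> v n"
  shows "admissible q w"
  using assms(1) unfolding admissible_def
  by (rule summable_comparison_test'[where N = 0]) (simp add: assms(2) mult_right_mono)

lemma admissible_add: "admissible q v \<Longrightarrow> admissible q w \<Longrightarrow> admissible q (\<lambda>n. v n + w n)"
  unfolding admissible_def by (drule (1) summable_add) (simp add: algebra_simps)

lemma admissible_mult: "admissible q w \<Longrightarrow> admissible q (\<lambda>n. c * w n)"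
  unfolding admissible_def by (drule summable_mult[of _ "real c"]) (simp add: algebra_simps)

lemma admissible_Suc:
  assumes "norm q < 1"
  shows "admissible q Suc"
  using sums_summable[OF geometric_deriv_sums[of "norm q"]] assms
  unfolding admissible_def by simp

lemma has_prod_wprod:
  assumes "admissible q w"
  shows "(\<lambda>n. (1 - q ^ n * y) ^ w n) has_prod wprod q w y"
  unfolding wprod_def
proof (intro convergent_prod_has_prod convergent_prod_if_norm_le_exp)
  show "summable (\<lambda>n. norm y * (real (w n) * norm q ^ n))"
    using assms unfolding admissible_def by (rule summable_mult)
  show "norm ((1 - q ^ n * y) ^ w n - 1) \<le> exp (norm y * (real (w n) * norm q ^ n)) - 1" for n
    using norm_one_minus_power_minus_1_le[of "q ^ n * y" "w n"]
    by (simp add: norm_mult norm_power mult_ac)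
qed simp

lemma norm_wprod_minus_1_le:
  assumes "admissible q w"
  shows "norm (wprod q w y - 1) \<le> exp (norm y * (\<Sum>n. real (w n) * norm q ^ n)) - 1"
proof (rule LIMSEQ_le_const2)
  show "(\<lambda>k. norm ((\<Prod>n<k. (1 - q ^ n * y) ^ w n) - 1)) \<longlonglongrightarrow> norm (wprod q w y - 1)"
    by (intro tendsto_intros has_prod_imp_tendsto' has_prod_wprod assms)
  have "norm ((\<Prod>n<k. (1 - q ^ n * y) ^ w n) - 1) \<le> exp (norm y * (\<Sum>n. real (w n) * norm q ^ n)) - 1" for k
  proof -
    have "norm ((\<Prod>n<k. (1 - q ^ n * y) ^ w n) - 1) \<le> exp (\<Sum>n<k. norm y * (real (w n) * norm q ^ n)) - 1"
    proof (rule norm_prod_minus_1_le_exp_sum)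
      show "norm ((1 - q ^ n * y) ^ w n - 1) \<le> exp (norm y * (real (w n) * norm q ^ n)) - 1" for n
        using norm_one_minus_power_minus_1_le[of "q ^ n * y" "w n"]
        by (simp add: norm_mult norm_power mult_ac)
    qed
    also have "(\<Sum>n<k. norm y * (real (w n) * norm q ^ n)) = norm y * (\<Sum>n<k. real (w n) * norm q ^ n)"
      by (simp add: sum_distrib_left)
    also have "\<dots> \<le> norm y * (\<Sum>n. real (w n) * norm q ^ n)"
      using assms by (intro mult_left_mono sum_le_suminf) (auto simp: admissible_def)
    finally show ?thesis by simp
  qed
  then show "\<exists>N. \<forall>k\<ge>N. norm ((\<Prod>n<k. (1 - q ^ n * y) ^ w n) - 1) \<le> exp (norm y * (\<Sum>n. real (w n) * norm q ^ n)) - 1"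
    by blast
qed

lemma wprod_0 [simp]: "wprod q (\<lambda>_. 0) y = 1"
  using has_prod_unique[OF has_prod_finite[of "{}" "\<lambda>_. 1 :: complex"]] by (simp add: wprod_def)

lemma wprod_add:
  assumes "admissible q v" "admissible q w"
  shows "wprod q (\<lambda>n. v n + w n) y = wprod q v y * wprod q w y"
  using has_prod_unique[OF has_prod_mult[OF assms[THEN has_prod_wprod]]]
  by (simp add: wprod_def power_add)

lemma wprod_mult:
  assumes "admissible q w"
  shows "wprod q (\<lambda>n. c * w n) y = wprod q w y ^ c"
  using has_prod_unique[OF has_prod_power[OF has_prod_wprod[OF assms, of y], of c]]
  by (simp add: wprod_def mult.commute[of c] power_mult)

lemma wprod_sum:
  assumes "finite A" "\<And>i. i \<in> A \<Longrightarrow> admissible q (w i)"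
  shows "admissible q (\<lambda>n. \<Sum>i\<in>A. w i n)"
    and "wprod q (\<lambda>n. \<Sum>i\<in>A. w i n) y = (\<Prod>i\<in>A. wprod q (w i) y)"
  using assms
proof (induction A rule: finite_induct)
  case empty
  { case 1 show ?case by (simp add: admissible_def) }
  { case 2 show ?case by simp }
next
  case (insert i A)
  { case 1 then show ?case using insert by (simp add: admissible_add) }
  { case 2 then show ?case using insert by (simp add: wprod_add) }
qed

lemma wprod_nonzero:
  assumes "admissible q w" and "\<And>n. w n > 0 \<Longrightarrow> q ^ n * y \<noteq> 1"
  shows "wprod q w y \<noteq> 0"
  using has_prod_eq_0_iff[OF has_prod_wprod[OF assms(1)], of y] assms(2) by force

text \<open>
  Fubini for weighted products: if the weights \<open>w j\<close> add up to \<open>N\<close>, then the products over \<open>w j\<close>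
  multiply to the product over \<open>N\<close>. The condition that \<open>w j\<close> is supported on \<open>{j..}\<close> makes the
  sum of the weights finite at each place, and makes the weight \<open>T J\<close> that is left after the first
  \<open>J + 1\<close> products supported beyond \<open>J\<close>. So \<open>wprod q (T J) y\<close> is bounded in terms of a tail of a
  convergent series and tends to \<open>1\<close>. No logarithms are taken, so vanishing factors are allowed.
\<close>

lemma has_prod_wprod_regroup:
  assumes N: "admissible q N"
    and sum: "\<And>n. (\<Sum>j\<le>n. w j n) = N n" and zero: "\<And>j n. n < j \<Longrightarrow> w j n = 0"
  shows "(\<lambda>j. wprod q (w j) y) has_prod wprod q N y"
proof (rule convergent_prod_tendsto_imp_has_prod)
  define t where "t n = norm q ^ n" for n
  define T where "T J n = (\<Sum>j\<in>{J<..n}. w j n)" for J n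
  have wN: "w j n \<le> N n" for j n
  proof (cases "j \<le> n")
    case True
    then show ?thesis
      unfolding sum[symmetric] by (intro member_le_sum) auto
  qed (simp add: zero)
  have adw: "admissible q (w j)" for j
    by (rule admissible_le[OF N wN])
  have split: "N n = (\<Sum>j\<le>J. w j n) + T J n" for J n
  proof (cases "J \<le> n")
    case True
    then have "{..n} = {..J} \<union> {J<..n}" by auto
    then have "N n = (\<Sum>j\<in>{..J} \<union> {J<..n}. w j n)" by (simp only: sum[symmetric])
    also have "\<dots> = (\<Sum>j\<le>J. w j n) + T J n"
      unfolding T_def by (rule sum.union_disjoint) auto
    finally show ?thesis .
  next
    case False
    have "(\<Sum>j\<le>J. w j n) = (\<Sum>j\<le>n. w j n)"
    proof (rule sum.mono_neutral_right)
      show "\<forall>j\<in>{..J} - {..n}. w j n = 0"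
        by (intro ballI zero) auto
    qed (use False in auto)
    then show ?thesis
      using False by (simp add: T_def sum)
  qed
  have T0: "T J n = 0" if "n \<le> J" for J n
    using that by (simp add: T_def)
  have TN: "T J n \<le> N n" for J n
    using split[of n J] by simp
  have adT: "admissible q (T J)" for J
    by (rule admissible_le[OF N TN])
  have sN: "summable (\<lambda>n. real (N n) * t n)"
    using N by (simp add: admissible_def t_def)
  have sw: "summable (\<lambda>n. real (w j n) * t n)" for j
    using adw[of j] by (simp add: admissible_def t_def)
  have sT: "summable (\<lambda>n. real (T J n) * t n)" for J
    using adT[of J] by (simp add: admissible_def t_def)

  show "convergent_prod (\<lambda>j. wprod q (w j) y)"
  proof (rule convergent_prod_if_norm_le_exp)
    show "summable (\<lambda>j. norm y * (\<Sum>n. real (w j n) * t n))"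
    proof (intro summable_mult summableI_nonneg_bounded)
      show "0 \<le> (\<Sum>n. real (w j n) * t n)" for j
        by (intro suminf_nonneg sw) (simp add: t_def)
      show "(\<Sum>j<J. \<Sum>n. real (w j n) * t n) \<le> (\<Sum>n. real (N n) * t n)" for J
      proof -
        have "(\<Sum>j<J. \<Sum>n. real (w j n) * t n) = (\<Sum>n. \<Sum>j<J. real (w j n) * t n)"
          by (rule suminf_sum[symmetric]) (rule sw)
        also have "\<dots> \<le> (\<Sum>n. real (N n) * t n)"
        proof (rule suminf_le)
          show "(\<Sum>j<J. real (w j n) * t n) \<le> real (N n) * t n" for n
          proof -
            have "(\<Sum>j<J. w j n) \<le> (\<Sum>j\<le>J. w j n)"
              by (rule sum_mono2) auto
            also have "\<dots> \<le> N n" using split[of n J] by simp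
            finally have "real (\<Sum>j<J. w j n) * t n \<le> real (N n) * t n"
              by (intro mult_right_mono) (auto simp: t_def simp del: of_nat_sum)
            then show ?thesis by (simp add: sum_distrib_right)
          qed
        qed (intro summable_sum sw sN)+
        finally show ?thesis .
      qed
    qed
    show "0 \<le> norm y * (\<Sum>n. real (w j n) * t n)" for j
      by (intro mult_nonneg_nonneg suminf_nonneg sw) (simp_all add: t_def)
    show "norm (wprod q (w j) y - 1) \<le> exp (norm y * (\<Sum>n. real (w j n) * t n)) - 1" for j
      unfolding t_def by (rule norm_wprod_minus_1_le) (rule adw)
  qed

  have "(\<lambda>J. wprod q (T J) y - 1) \<longlonglongrightarrow> 0"
  proof (rule Lim_null_comparison)
    \<comment> \<open>As \<open>T J n \<le> N n\<close>, with \<open>T J n = 0\<close> for \<open>n \<le> J\<close>, this tail bounds the sum belonging to \<open>T J\<close>.\<close>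
    define R where "R J = (\<Sum>n. real (N (n + Suc J)) * t (n + Suc J))" for J
    show "eventually (\<lambda>J. norm (wprod q (T J) y - 1) \<le> exp (norm y * R J) - 1) sequentially"
    proof (intro always_eventually allI)
      fix J
      have "(\<Sum>n. real (T J n) * t n) = (\<Sum>n. real (T J (n + Suc J)) * t (n + Suc J))"
        using suminf_split_initial_segment[OF sT[of J], of "Suc J"] by (simp add: T0)
      also have "\<dots> \<le> R J"
        unfolding R_def
        by (intro suminf_le mult_right_mono summable_ignore_initial_segment[of "\<lambda>n. real (T J n) * t n"]
            summable_ignore_initial_segment[of "\<lambda>n. real (N n) * t n"] sT sN)
           (auto simp: TN t_def)
      finally have "norm y * (\<Sum>n. real (T J n) * t n) \<le> norm y * R J"
        by (simp add: mult_left_mono)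
      moreover have "norm (wprod q (T J) y - 1) \<le> exp (norm y * (\<Sum>n. real (T J n) * t n)) - 1"
        unfolding t_def by (rule norm_wprod_minus_1_le) (rule adT)
      ultimately show "norm (wprod q (T J) y - 1) \<le> exp (norm y * R J) - 1"
        by (smt (verit) exp_le_cancel_iff)
    qed
    have "(\<lambda>J. (\<Sum>n. real (N n) * t n) - (\<Sum>n<J. real (N n) * t n)) \<longlonglongrightarrow> (\<Sum>n. real (N n) * t n) - (\<Sum>n. real (N n) * t n)"
      by (intro tendsto_intros summable_LIMSEQ sN)
    then have "(\<lambda>J. (\<Sum>n. real (N (n + J)) * t (n + J))) \<longlonglongrightarrow> 0"
      using suminf_minus_initial_segment[OF sN] by simp
    then have "R \<longlonglongrightarrow> 0"
      unfolding R_def by (rule LIMSEQ_Suc)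
    then have "(\<lambda>J. exp (norm y * R J) - 1) \<longlonglongrightarrow> exp (norm y * 0) - 1"
      by (intro tendsto_intros)
    then show "(\<lambda>J. exp (norm y * R J) - 1) \<longlonglongrightarrow> 0" by simp
  qed
  then have T1: "(\<lambda>J. wprod q (T J) y) \<longlonglongrightarrow> 1"
    by (simp add: LIM_zero_iff)
  \<comment> \<open>Eventually the remaining factor is nonzero, and the partial products are these quotients.\<close>
  have "(\<lambda>J. wprod q N y / wprod q (T J) y) \<longlonglongrightarrow> wprod q N y / 1"
    by (intro tendsto_intros T1) simp
  moreover have "eventually (\<lambda>J. wprod q (T J) y \<noteq> 0) sequentially"
    by (rule tendsto_imp_eventually_ne[OF T1]) simp
  then have "eventually (\<lambda>J. wprod q N y / wprod q (T J) y = (\<Prod>j\<le>J. wprod q (w j) y)) sequentially"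
  proof eventually_elim
    case (elim J)
    have "wprod q N y = wprod q (\<lambda>n. (\<Sum>j\<le>J. w j n) + T J n) y"
      by (rule arg_cong[of _ _ "\<lambda>N. wprod q N y"]) (rule ext, rule split)
    also have "\<dots> = (\<Prod>j\<le>J. wprod q (w j) y) * wprod q (T J) y"
      by (simp add: wprod_add wprod_sum adw adT)
    finally show ?case
      using elim by simp
  qed
  ultimately show "(\<lambda>J. \<Prod>j\<le>J. wprod q (w j) y) \<longlonglongrightarrow> wprod q N y"
    by (simp add: filterlim_cong)
qed

section \<open>Gamma and theta functions as weighted products\<close>

lemma admissible_if_le_Suc:
  assumes "norm q < 1" "\<And>n. w n \<le> Suc n"
  shows "admissible q w"
  using admissible_le[OF admissible_Suc[OF assms(1)] assms(2)] .

lemma admissible_num_reps: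
  assumes "norm q < 1" "a > 0" "b > 0"
  shows "admissible q (num_reps a b)"
  using assms(1) num_reps_le[OF assms(2,3)] by (rule admissible_if_le_Suc)

lemma wprod_single: "wprod q (\<lambda>n. if n = m then 1 else 0) y = 1 - q ^ m * y"
proof -
  have "wprod q (\<lambda>n. if n = m then 1 else 0) y = (\<Prod>n\<in>{m}. (1 - q ^ n * y) ^ (if n = m then 1 else 0))"
    unfolding wprod_def by (rule prodinf_finite) auto
  then show ?thesis by simp
qed

lemma wprod_shift:
  assumes "admissible q w"
  shows "wprod q (\<lambda>n. if n < s then 0 else w (n - s)) y = wprod q w (q ^ s * y)"
proof -
  let ?f = "\<lambda>n. (1 - q ^ n * y) ^ (if n < s then 0 else w (n - s))"
  have "(\<lambda>n. ?f (n + s)) has_prod wprod q w (q ^ s * y)"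
    using has_prod_wprod[OF assms, of "q ^ s * y"] by (simp add: power_add mult_ac)
  then have "?f has_prod wprod q w (q ^ s * y)"
    by (subst (asm) has_prod_one_iff_shift) auto
  from has_prod_unique[OF this] show ?thesis
    by (simp add: wprod_def)
qed

lemma card_progression:
  fixes r K n :: nat
  assumes "K > 0"
  shows "finite {k. n = r + K * k}" "card {k. n = r + K * k} \<le> 1"
proof -
  have sub: "{k. n = r + K * k} \<subseteq> {(n - r) div K}"
    using assms by auto
  then show "finite {k. n = r + K * k}" by (rule finite_subset) simp
  show "card {k. n = r + K * k} \<le> 1"
    using card_mono[OF _ sub] by simp
qed

text \<open>The product over a progression is the regrouping of the weights \<open>1\<close> at a single place.\<close>

lemma has_prod_progression:
  assumes "norm q < 1" "b > 0"
  shows "(\<lambda>k. 1 - q ^ (m + b * k) * y) has_prod wprod q (\<lambda>n. card {k. n = m + b * k}) y"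
proof -
  have *: "{k. n = m + b * k} = {k \<in> {..n}. n = m + b * k}" for n
    using assms(2) by (auto intro: trans_le_add2)
  have "(\<lambda>k. wprod q (\<lambda>n. if n = m + b * k then 1 else 0) y) has_prod
          wprod q (\<lambda>n. card {k. n = m + b * k}) y"
  proof (rule has_prod_wprod_regroup)
    show "admissible q (\<lambda>n. card {k. n = m + b * k})"
      using assms(1)
    proof (rule admissible_if_le_Suc)
      show "card {k. n = m + b * k} \<le> Suc n" for n
        using card_progression(2)[OF assms(2), of n m] by linarith
    qed
    show "(\<Sum>k\<le>n. if n = m + b * k then 1 else 0) = card {k. n = m + b * k}" for n
      unfolding * by (subst sum.inter_filter[symmetric]) auto
    show "(if n = m + b * k then 1 else 0) = 0" if "n < k" for k n :: nat
    proof -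
      have "k \<le> b * k" using assms(2) by simp
      then have "n \<noteq> m + b * k" using that by linarith
      then show ?thesis by simp
    qed
  qed
  then show ?thesis by (simp only: wprod_single)
qed

lemma has_prod_double_progression:
  assumes "norm q < 1" "a > 0" "b > 0"
  shows "(\<lambda>j. wprod q (\<lambda>n. card {k. n = a * j + b * k}) y) has_prod wprod q (num_reps a b) y"
proof (rule has_prod_wprod_regroup)
  show "admissible q (num_reps a b)" by (rule admissible_num_reps) fact+
  show "(\<Sum>j\<le>n. card {k. n = a * j + b * k}) = num_reps a b n" for n
  proof -
    have "{(j, k). n = a * j + b * k} = Sigma {..n} (\<lambda>j. {k. n = a * j + b * k})"
    proof -
      have "j \<le> a * j + b * k" for j k
        using assms(2) by (intro trans_le_add1) simp
      then show ?thesis by auto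
    qed
    then show ?thesis
      unfolding num_reps_def using card_progression(1)[OF assms(3)] by simp
  qed
  show "card {k. n = a * j + b * k} = 0" if "n < j" for j n
  proof -
    have "j \<le> a * j" using assms(2) by simp
    then have "n \<noteq> a * j + b * k" for k using that by linarith
    then show ?thesis by simp
  qed
qed

text \<open>No condition on \<open>z\<close> is needed: at a pole the denominator on the right-hand side is \<open>0\<close>, and both
  sides are \<open>0\<close>.\<close>

lemma elliptic_gamma_eq_wprod:
  assumes "norm q < 1" "a > 0" "b > 0" and q: "q = exp (2 * of_real pi * \<i> * \<tau>)"
  shows "elliptic_gamma z (of_nat a * \<tau>) (of_nat b * \<tau>) =
           wprod q (num_reps a b) (q ^ (a + b) * exp (- 2 * of_real pi * \<i> * z)) /
           wprod q (num_reps a b) (exp (2 * of_real pi * \<i> * z))"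
proof -
  define x where "x = exp (2 * of_real pi * \<i> * z)"
  define x' where "x' = q ^ (a + b) * exp (- 2 * of_real pi * \<i> * z)"
  have num: "exp (2 * of_real pi * \<i> * ((of_nat j + 1) * (of_nat a * \<tau>) + (of_nat k + 1) * (of_nat b * \<tau>) - z))
          = q ^ (a * j + b * k) * x'" for j k
    unfolding q x'_def by (simp add: algebra_simps flip: exp_of_nat_mult exp_add power_add)
  have den: "exp (2 * of_real pi * \<i> * (of_nat j * (of_nat a * \<tau>) + of_nat k * (of_nat b * \<tau>) + z))
          = q ^ (a * j + b * k) * x" for j k
    unfolding q x_def by (simp add: algebra_simps flip: exp_of_nat_mult exp_add)
  let ?w = "\<lambda>j n. card {k. n = a * j + b * k}"
  have "elliptic_gamma z (of_nat a * \<tau>) (of_nat b * \<tau>) =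
          (\<Prod>j. \<Prod>k. (1 - q ^ (a * j + b * k) * x') / (1 - q ^ (a * j + b * k) * x))"
    unfolding elliptic_gamma_def num den ..
  also have "\<dots> = (\<Prod>j. wprod q (?w j) x' / wprod q (?w j) x)"
    by (intro arg_cong[of _ _ prodinf] ext has_prod_unique[symmetric] has_prod_divide
        has_prod_progression assms(1,3))
  also have "\<dots> = wprod q (num_reps a b) x' / wprod q (num_reps a b) x"
    by (intro has_prod_unique[symmetric] has_prod_divide has_prod_double_progression assms(1-3))
  finally show ?thesis unfolding x_def x'_def .
qed

lemma theta0_eq_wprod:
  fixes K k :: nat
  assumes "norm q < 1" "k < K" and q: "q = exp (2 * of_real pi * \<i> * \<tau>)"
  shows "theta0 (z + of_nat k * \<tau>) (of_nat K * \<tau>) =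
           wprod q (\<lambda>n. if k = K - 1 - n mod K then 1 else 0) (q * exp (- 2 * of_real pi * \<i> * z)) *
           wprod q (\<lambda>n. if k = n mod K then 1 else 0) (exp (2 * of_real pi * \<i> * z))"
proof -
  define x where "x = exp (2 * of_real pi * \<i> * z)"
  define x' where "x' = q * exp (- 2 * of_real pi * \<i> * z)"
  define l where "l = K - 1 - k"
  have K: "K = k + l + 1" using assms(2) by (simp add: l_def)
  have num: "exp (2 * of_real pi * \<i> * ((of_nat j + 1) * (of_nat K * \<tau>) - (z + of_nat k * \<tau>)))
          = q ^ (l + K * j) * x'" for j
    unfolding q x'_def by (simp add: K algebra_simps flip: exp_of_nat_mult exp_add)
  have den: "exp (2 * of_real pi * \<i> * (of_nat j * (of_nat K * \<tau>) + (z + of_nat k * \<tau>)))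
          = q ^ (k + K * j) * x" for j
    unfolding q x_def by (simp add: algebra_simps flip: exp_of_nat_mult exp_add)
  have card: "card {j. n = r + K * j} = (if r = n mod K then 1 else 0)" if "r < K" for r n
  proof (cases "r = n mod K")
    case True
    have "j = n div K" if "n = r + K * j" for j
      using that \<open>r < K\<close> by simp
    moreover have "n = r + K * (n div K)"
      using True by simp
    ultimately have "{j. n = r + K * j} = {n div K}"
      by blast
    then show ?thesis using True by simp
  next
    case False
    then have "{j. n = r + K * j} = {}" using that by auto
    then show ?thesis using False by simp
  qed
  have l: "l < K" and k: "k < K" by (simp_all add: K)
  have iff: "l = n mod K \<longleftrightarrow> k = K - 1 - n mod K" for n
    using mod_less_divisor[of K n] K by linarith
  have "(\<lambda>j. (1 - q ^ (l + K * j) * x') * (1 - q ^ (k + K * j) * x)) has_prod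
          (wprod q (\<lambda>n. card {j. n = l + K * j}) x' * wprod q (\<lambda>n. card {j. n = k + K * j}) x)"
    by (intro has_prod_mult has_prod_progression assms(1)) (simp_all add: K)
  then show ?thesis
    unfolding theta0_def num den card[OF l] card[OF k] iff x_def x'_def
    by (rule has_prod_unique[symmetric])
qed

section \<open>The comparison of multiplicities\<close>

lemma num_reps_1_1: "num_reps 1 1 n = Suc n"
proof -
  have "\<exists>r s :: nat. 0 = 1 * r + 1 * s" by simp
  then have "theta_exponent 1 1 0 = 0"
    unfolding theta_exponent_def by simp
  then have "int (num_reps 1 1 n) = int n + 1"
    using num_reps_plus_theta_exponent[OF coprime_1_left zero_less_one zero_less_one, of n]
    by (simp only: mult_1 mod_by_1 of_nat_1 add_0_right)
  then show ?thesis by linarith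
qed

text \<open>Both sides of the comparison have this shape, with \<open>f n\<close> the index \<open>k\<close> of the only theta function
  that contains the factor \<open>1 - q^n y\<close>.\<close>

lemma wprod_theta_factors:
  fixes K :: nat and f :: "nat \<Rightarrow> nat"
  assumes "norm q < 1" "admissible q v"
  shows "wprod q (\<lambda>n. c * v n + (\<Sum>k<K. m k * (if k = f n then 1 else 0))) y =
     wprod q v y ^ c * (\<Prod>k<K. wprod q (\<lambda>n. if k = f n then 1 else 0) y ^ m k)"
proof -
  have ad: "admissible q (\<lambda>n. if k = f n then 1 else 0)" for k
    using assms(1) by (rule admissible_if_le_Suc) simp
  let ?w = "\<lambda>k n. m k * (if k = f n then 1 else 0)"
  have adw: "admissible q (?w k)" for k
    using ad by (rule admissible_mult)
  have "wprod q (\<lambda>n. c * v n + (\<Sum>k<K. ?w k n)) y = wprod q (\<lambda>n. c * v n) y * wprod q (\<lambda>n. \<Sum>k<K. ?w k n) y"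
    by (intro wprod_add admissible_mult wprod_sum(1) assms(2) finite_lessThan ad)
  also have "wprod q (\<lambda>n. c * v n) y = wprod q v y ^ c"
    by (rule wprod_mult) fact
  also have "wprod q (\<lambda>n. \<Sum>k<K. ?w k n) y = (\<Prod>k<K. wprod q (?w k) y)"
    by (intro wprod_sum(2) finite_lessThan adw)
  also have "\<dots> = (\<Prod>k<K. wprod q (\<lambda>n. if k = f n then 1 else 0) y ^ m k)"
    by (intro prod.cong refl wprod_mult ad)
  finally show ?thesis .
qed

lemma elliptic_gamma_power_eq:
  assumes "norm q < 1" "coprime a b" "a > 0" "b > 0" and q: "q = exp (2 * of_real pi * \<i> * \<tau>)"
    and den: "\<And>n. q ^ n * exp (2 * of_real pi * \<i> * z) \<noteq> 1"
    and theta: "\<And>k. k < a * b \<Longrightarrow> theta_exponent a b k < 0 \<Longrightarrow>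
                  theta0 (z + of_nat k * \<tau>) (of_nat (a * b) * \<tau>) \<noteq> 0"
  shows "elliptic_gamma z (of_nat a * \<tau>) (of_nat b * \<tau>) ^ (a * b) =
           elliptic_gamma z \<tau> \<tau> *
           (\<Prod>k < a * b. theta0 (z + of_nat k * \<tau>) (of_nat (a * b) * \<tau>) powi theta_exponent a b k)"
proof -
  define K where "K = a * b"
  have "K > 0" using assms by (simp add: K_def)
  define x where "x = exp (2 * of_real pi * \<i> * z)"
  define x' where "x' = exp (- 2 * of_real pi * \<i> * z)"
  define u where "u = q * x'"
  let ?\<alpha> = "theta_exponent a b"
  \<comment> \<open>Positive and negative parts of the exponents; the factors with exponent \<open>- m k\<close> change sides.\<close>
  define p where "p k = nat (?\<alpha> k)" for k
  define m where "m k = nat (- ?\<alpha> k)" for k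
  have pm: "int (p k) - int (m k) = ?\<alpha> k" for k
    by (simp add: p_def m_def)
  define N where "N = num_reps a b"
  \<comment> \<open>Multiplicity of \<open>1 - q^n u\<close> in the numerator of \<open>\<Gamma>(z, a \<tau>, b \<tau>)\<close>, since \<open>q^(a+b) x' = q^(a+b-1) u\<close>.\<close>
  define N' where "N' n = (if n < a + b - 1 then 0 else N (n - (a + b - 1)))" for n
  define A where "A k = wprod q (\<lambda>n. if k = n mod K then 1 else 0) x" for k
  define B where "B k = wprod q (\<lambda>n. if k = K - 1 - n mod K then 1 else 0) u" for k
  define \<theta> where "\<theta> k = theta0 (z + of_nat k * \<tau>) (of_nat K * \<tau>)" for k
  have adN: "admissible q N"
    unfolding N_def by (rule admissible_num_reps) fact+
  have adS: "admissible q Suc" by (rule admissible_Suc) fact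
  have adI: "admissible q (\<lambda>n. n)" by (rule admissible_if_le_Suc) (use assms in auto)
  have adN': "admissible q N'"
    using assms(1)
  proof (rule admissible_if_le_Suc)
    fix n
    have "N (n - (a + b - 1)) \<le> Suc (n - (a + b - 1))"
      unfolding N_def by (rule num_reps_le) fact+
    also have "\<dots> \<le> Suc n" by simp
    finally show "N' n \<le> Suc n" by (simp add: N'_def)
  qed

  have gamma_ab: "elliptic_gamma z (of_nat a * \<tau>) (of_nat b * \<tau>) = wprod q N' u / wprod q N x"
  proof -
    have "q ^ (a + b) * x' = q ^ (a + b - 1) * u"
      using assms(3) by (simp add: u_def power_eq_if flip: mult.assoc power_Suc2)
    then show ?thesis
      using wprod_shift[OF adN, of "a + b - 1" u]
        elliptic_gamma_eq_wprod[OF assms(1,3,4) q, of z, folded x_def x'_def N_def]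
      by (simp add: N'_def[abs_def])
  qed
  have gamma_11: "elliptic_gamma z \<tau> \<tau> = wprod q (\<lambda>n. n) u / wprod q Suc x"
  proof -
    have "(\<lambda>n. if n < 1 then 0 else Suc (n - 1)) = (\<lambda>n. n)" by auto
    then have "wprod q Suc (q ^ (1 + 1) * x') = wprod q (\<lambda>n. n) u"
      using wprod_shift[OF adS, of 1 u] by (simp add: u_def mult.assoc)
    moreover have "num_reps 1 1 = Suc" by (rule ext) (rule num_reps_1_1)
    ultimately show ?thesis
      using elliptic_gamma_eq_wprod[OF assms(1) zero_less_one zero_less_one q, of z, folded x_def x'_def]
      by simp
  qed
  have theta_eq: "\<theta> k = B k * A k" if "k < K" for k
    unfolding \<theta>_def A_def B_def u_def x_def x'_def
    using assms(1) that q by (rule theta0_eq_wprod)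

  have "(\<lambda>n. K * N n + (\<Sum>k<K. p k * (if k = n mod K then 1 else 0))) =
        (\<lambda>n. 1 * Suc n + (\<Sum>k<K. m k * (if k = n mod K then 1 else 0)))"
  proof
    fix n
    have lt: "n mod K < K" using \<open>K > 0\<close> by simp
    have "int (K * N n + p (n mod K)) = int (1 * Suc n + m (n mod K))"
      using num_reps_plus_theta_exponent[OF assms(2-4), of n] pm[of "n mod K"]
      by (simp add: K_def N_def)
    then have "K * N n + p (n mod K) = 1 * Suc n + m (n mod K)"
      unfolding of_nat_eq_iff .
    then show "K * N n + (\<Sum>k<K. p k * (if k = n mod K then 1 else 0)) =
        1 * Suc n + (\<Sum>k<K. m k * (if k = n mod K then 1 else 0))"
      using lt by (simp add: if_distrib sum.delta cong: if_cong)
  qed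
  from arg_cong[OF this, of "\<lambda>w. wprod q w x"]
  have den_eq: "wprod q N x ^ K * (\<Prod>k<K. A k ^ p k) = wprod q Suc x * (\<Prod>k<K. A k ^ m k)"
    unfolding A_def wprod_theta_factors[OF assms(1) adN] wprod_theta_factors[OF assms(1) adS] by simp

  have "(\<lambda>n. K * N' n + (\<Sum>k<K. m k * (if k = K - 1 - n mod K then 1 else 0))) =
        (\<lambda>n. 1 * n + (\<Sum>k<K. p k * (if k = K - 1 - n mod K then 1 else 0)))"
  proof
    fix n
    have lt: "K - 1 - n mod K < K" using \<open>K > 0\<close> by simp
    have N': "N' n = (if n + 1 < a + b then 0 else num_reps a b (n + 1 - (a + b)))"
      unfolding N'_def N_def using assms(3) by (auto intro!: arg_cong[of _ _ "num_reps a b"])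
    have "int (K * N' n + m (K - 1 - n mod K)) = int (1 * n + p (K - 1 - n mod K))"
      using num_reps_shifted_eq_theta_exponent[OF assms(2-4), of n] pm[of "K - 1 - n mod K"]
      unfolding N' K_def of_nat_add of_nat_mult[of "a * b"] by linarith
    then have "K * N' n + m (K - 1 - n mod K) = 1 * n + p (K - 1 - n mod K)"
      unfolding of_nat_eq_iff .
    then show "K * N' n + (\<Sum>k<K. m k * (if k = K - 1 - n mod K then 1 else 0)) =
        1 * n + (\<Sum>k<K. p k * (if k = K - 1 - n mod K then 1 else 0))"
      using lt by (simp add: if_distrib sum.delta cong: if_cong)
  qed
  from arg_cong[OF this, of "\<lambda>w. wprod q w u"]
  have num_eq: "wprod q N' u ^ K * (\<Prod>k<K. B k ^ m k) = wprod q (\<lambda>n. n) u * (\<Prod>k<K. B k ^ p k)"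
    unfolding B_def wprod_theta_factors[OF assms(1) adN'] wprod_theta_factors[OF assms(1) adI] by simp

  have N_nz: "wprod q N x \<noteq> 0"
    by (rule wprod_nonzero[OF adN]) (use den in \<open>simp add: x_def\<close>)
  have S_nz: "wprod q Suc x \<noteq> 0"
    by (rule wprod_nonzero[OF adS]) (use den in \<open>simp add: x_def\<close>)
  have m_nz: "\<theta> k ^ m k \<noteq> 0" if "k < K" for k
    using theta[of k] that by (cases "?\<alpha> k < 0") (auto simp: \<theta>_def K_def m_def)
  have powi: "\<theta> k powi ?\<alpha> k = \<theta> k ^ p k / \<theta> k ^ m k" for k
    by (auto simp: power_int_def p_def m_def field_simps)
  let ?pp = "(\<Prod>k<K. B k ^ p k) * (\<Prod>k<K. A k ^ p k)"
  let ?mm = "(\<Prod>k<K. B k ^ m k) * (\<Prod>k<K. A k ^ m k)"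
  have p_eq: "(\<Prod>k<K. \<theta> k ^ p k) = ?pp"
    by (simp add: theta_eq power_mult_distrib prod.distrib)
  have m_eq: "(\<Prod>k<K. \<theta> k ^ m k) = ?mm"
    by (simp add: theta_eq power_mult_distrib prod.distrib)
  have "(\<Prod>k<K. \<theta> k ^ m k) \<noteq> 0"
    using m_nz by simp
  then have mm_nz: "?mm \<noteq> 0"
    by (simp only: m_eq not_False_eq_True)
  have "wprod q N' u ^ K * (wprod q Suc x * ?mm) = wprod q (\<lambda>n. n) u * ?pp * wprod q N x ^ K"
    using arg_cong2[OF num_eq den_eq[symmetric], of "(*)"] by (simp only: mult_ac)
  then have "wprod q N' u ^ K / wprod q N x ^ K = wprod q (\<lambda>n. n) u * ?pp / (wprod q Suc x * ?mm)"
    by (subst frac_eq_eq) (use N_nz S_nz mm_nz in \<open>simp_all only: power_not_zero mult_eq_0_iff simp_thms\<close>)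
  also have "\<dots> = wprod q (\<lambda>n. n) u / wprod q Suc x * (?pp / ?mm)"
    by (rule times_divide_times_eq[symmetric])
  also have "?pp / ?mm = (\<Prod>k<K. \<theta> k powi ?\<alpha> k)"
    by (simp only: powi prod_dividef p_eq m_eq)
  finally show ?thesis
    unfolding K_def[symmetric] \<theta>_def[symmetric] gamma_ab gamma_11 power_divide .
qed

section \<open>Isolation of zeros and poles\<close>

text \<open>Near \<open>z0\<close> the values \<open>x\<close> and \<open>1/x\<close> are bounded, so only finitely many of the equations can hold,
  and each of them prescribes the value of \<open>x\<close>, which is attained at isolated points only.\<close>

lemma eventually_no_vanishing_factor:
  fixes q z0 :: complex
  assumes "norm q < 1" "q \<noteq> 0"
  shows "eventually (\<lambda>z. \<forall>n. q ^ n * exp (2 * of_real pi * \<i> * z) \<noteq> 1 \<and>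
           q ^ n * (q * exp (- 2 * of_real pi * \<i> * z)) \<noteq> 1) (at z0)"
proof -
  define X where "X z = exp (2 * of_real pi * \<i> * z)" for z :: complex
  define X' where "X' z = exp (- 2 * of_real pi * \<i> * z)" for z :: complex
  have XX': "X z * X' z = 1" for z
    by (simp add: X_def X'_def flip: exp_add)
  have lim: "(X \<longlongrightarrow> X z0) (at z0)" "(X' \<longlongrightarrow> X' z0) (at z0)"
    unfolding X_def X'_def by (intro tendsto_intros)+
  have ne: "eventually (\<lambda>z. X z \<noteq> s) (at z0)" for s
  proof (cases "X z0 = s")
    case False
    then show ?thesis by (rule tendsto_imp_eventually_ne[OF lim(1)])
  next
    case True
    have "X z \<noteq> s" if "z \<noteq> z0" "dist z z0 < 1" for z
    proof
      assume "X z = s"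
      then have "exp (2 * of_real pi * \<i> * z) = exp (2 * of_real pi * \<i> * z0)"
        using True by (simp add: X_def)
      moreover have "\<bar>Re z - Re z0\<bar> < 1"
        using abs_Re_le_cmod[of "z - z0"] that(2) by (simp add: dist_norm)
      then have "\<bar>Im (2 * of_real pi * \<i> * z) - Im (2 * of_real pi * \<i> * z0)\<bar> < 2 * pi"
        by (simp add: abs_mult flip: right_diff_distrib)
      ultimately have "2 * of_real pi * \<i> * z = 2 * of_real pi * \<i> * z0"
        by (rule exp_complex_eqI[rotated])
      then show False using that(1) by simp
    qed
    then show ?thesis
      unfolding eventually_at by (intro exI[of _ 1]) auto
  qed
  define C where "C = norm (X z0) + norm (X' z0) + 1"
  have bound: "eventually (\<lambda>z. norm (X z) < C) (at z0)" "eventually (\<lambda>z. norm (X' z) < C) (at z0)"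
    by (rule order_tendstoD(2)[OF tendsto_norm[OF lim(1)]], simp add: C_def add_nonneg_pos)
       (rule order_tendstoD(2)[OF tendsto_norm[OF lim(2)]], simp add: C_def add_nonneg_pos)
  have "(\<lambda>n. norm q ^ n * C) \<longlonglongrightarrow> 0 * C"
    by (intro tendsto_intros LIMSEQ_power_zero) (use assms in auto)
  then have "eventually (\<lambda>n. norm q ^ n * C < 1) sequentially"
    by (intro order_tendstoD(2)[where y = 0]) auto
  then obtain M where M: "\<And>n. n \<ge> M \<Longrightarrow> norm q ^ n * C < 1"
    by (auto simp: eventually_sequentially)
  have "eventually (\<lambda>z. \<forall>n\<in>{..<M}. X z \<noteq> 1 / q ^ n \<and> X z \<noteq> q ^ Suc n) (at z0)"
    by (intro eventually_ball_finite ballI eventually_conj ne) auto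
  then show ?thesis
    using bound
  proof eventually_elim
    case (elim z)
    show ?case
    proof (fold X_def X'_def, intro allI conjI)
      fix n
      have large: "norm (q ^ n * v) < 1" if "norm v < C" "n \<ge> M" for v
      proof -
        have "norm (q ^ n * v) \<le> norm q ^ n * C"
          using that by (simp add: norm_mult norm_power mult_left_mono)
        then show ?thesis using M[OF that(2)] by simp
      qed
      show "q ^ n * X z \<noteq> 1"
      proof (cases "n < M")
        case True
        then show ?thesis using elim(1) assms(2) by (auto simp: field_simps)
      next
        case False
        then show ?thesis using large[OF elim(2)] by auto
      qed
      show "q ^ n * (q * X' z) \<noteq> 1"
      proof (cases "n < M")
        case True
        have "X z = q ^ Suc n" if "q ^ n * (q * X' z) = 1"
        proof -
          have "X z = X z * (q ^ n * (q * X' z))" using that by simp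
          also have "\<dots> = q ^ Suc n * (X z * X' z)" by simp
          finally show ?thesis by (simp add: XX')
        qed
        then show ?thesis using elim(1) True by blast
      next
        case False
        have "norm (q * X' z) \<le> 1 * norm (X' z)"
          unfolding norm_mult using assms(1) by (intro mult_right_mono) auto
        then have "norm (q * X' z) < C" using elim(3) by simp
        then show ?thesis using large[of "q * X' z"] False by auto
      qed
    qed
  qed
qed

section \<open>The product formula\<close>

(* The second conjunct is the identity at every point where all factors are defined (no zero
   denominator in Gamma(z,tau,tau), no zero theta factor raised to a negative power). The third
   is the identity of meromorphic functions, including the points where poles and zeros of the
   factors on the right-hand side cancel. *)
theorem theorem5p5:
  fixes a b :: nat and \<tau> q :: complex
  assumes "a > 0" and "b > 0" and "gcd a b = 1"
    and "Im \<tau> > 0" and "q = exp (2 * of_real pi * \<i> * \<tau>)"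
  shows "(\<forall>z. z \<notin> elliptic_gamma_poles (of_nat a * \<tau>) (of_nat b * \<tau>) \<longrightarrow>
            (\<lambda>j. ((1 - q ^ (j + a + b) * exp (- 2 * of_real pi * \<i> * z)) /
                  (1 - q ^ j * exp (2 * of_real pi * \<i> * z))) ^ num_reps a b j)
              has_prod elliptic_gamma z (of_nat a * \<tau>) (of_nat b * \<tau>))
       \<and> (\<forall>z. z \<notin> elliptic_gamma_poles \<tau> \<tau> \<longrightarrow>
            (\<forall>k < a * b. theta_exponent a b k < 0 \<longrightarrow>
               theta0 (z + of_nat k * \<tau>) (of_nat (a * b) * \<tau>) \<noteq> 0) \<longrightarrow>
            elliptic_gamma z (of_nat a * \<tau>) (of_nat b * \<tau>) ^ (a * b) =
              elliptic_gamma z \<tau> \<tau> *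
              (\<Prod>k < a * b. theta0 (z + of_nat k * \<tau>) (of_nat (a * b) * \<tau>) powi theta_exponent a b k))
       \<and> remove_sings (\<lambda>z. elliptic_gamma z (of_nat a * \<tau>) (of_nat b * \<tau>) ^ (a * b)) =
          remove_sings (\<lambda>z. elliptic_gamma z \<tau> \<tau> *
              (\<Prod>k < a * b. theta0 (z + of_nat k * \<tau>) (of_nat (a * b) * \<tau>) powi theta_exponent a b k))"
proof (intro conjI allI impI)
  have cop: "coprime a b" using assms(3) by (simp add: coprime_iff_gcd_eq_1)
  have q1: "norm q < 1" using assms(4) by (simp add: assms(5))
  have q0: "q \<noteq> 0" by (simp add: assms(5))
  show "(\<lambda>j. ((1 - q ^ (j + a + b) * exp (- 2 * of_real pi * \<i> * z)) /
                  (1 - q ^ j * exp (2 * of_real pi * \<i> * z))) ^ num_reps a b j)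
              has_prod elliptic_gamma z (of_nat a * \<tau>) (of_nat b * \<tau>)" for z
    using has_prod_divide[OF has_prod_wprod has_prod_wprod,
        OF admissible_num_reps admissible_num_reps, OF q1 assms(1,2) q1 assms(1,2),
        of "q ^ (a + b) * exp (- 2 * of_real pi * \<i> * z)" "exp (2 * of_real pi * \<i> * z)"]
    unfolding elliptic_gamma_eq_wprod[OF q1 assms(1,2,5)]
    by (simp add: power_divide power_add mult.assoc)
  show "elliptic_gamma z (of_nat a * \<tau>) (of_nat b * \<tau>) ^ (a * b) =
          elliptic_gamma z \<tau> \<tau> *
          (\<Prod>k < a * b. theta0 (z + of_nat k * \<tau>) (of_nat (a * b) * \<tau>) powi theta_exponent a b k)"
    if "z \<notin> elliptic_gamma_poles \<tau> \<tau>" and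
      theta: "\<forall>k < a * b. theta_exponent a b k < 0 \<longrightarrow>
               theta0 (z + of_nat k * \<tau>) (of_nat (a * b) * \<tau>) \<noteq> 0" for z
  proof (rule elliptic_gamma_power_eq[OF q1 cop assms(1,2,5)])
    show "q ^ n * exp (2 * of_real pi * \<i> * z) \<noteq> 1" for n
    proof -
      have "1 - exp (2 * of_real pi * \<i> * (of_nat n * \<tau> + of_nat 0 * \<tau> + z)) \<noteq> 0"
        using that(1) unfolding elliptic_gamma_poles_def by blast
      moreover have "exp (2 * of_real pi * \<i> * (of_nat n * \<tau> + of_nat 0 * \<tau> + z)) =
          q ^ n * exp (2 * of_real pi * \<i> * z)"
        unfolding assms(5) by (simp add: algebra_simps flip: exp_of_nat_mult exp_add)
      ultimately show ?thesis by simp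
    qed
  qed (use theta in blast)
  show "remove_sings (\<lambda>z. elliptic_gamma z (of_nat a * \<tau>) (of_nat b * \<tau>) ^ (a * b)) =
          remove_sings (\<lambda>z. elliptic_gamma z \<tau> \<tau> *
              (\<Prod>k < a * b. theta0 (z + of_nat k * \<tau>) (of_nat (a * b) * \<tau>) powi theta_exponent a b k))"
  proof (rule ext, rule remove_sings_cong[OF _ refl])
    fix z0
    show "eventually (\<lambda>z. elliptic_gamma z (of_nat a * \<tau>) (of_nat b * \<tau>) ^ (a * b) =
          elliptic_gamma z \<tau> \<tau> *
          (\<Prod>k < a * b. theta0 (z + of_nat k * \<tau>) (of_nat (a * b) * \<tau>) powi theta_exponent a b k)) (at z0)"
      using eventually_no_vanishing_factor[OF q1 q0]
    proof eventually_elim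
      case (elim z)
      show ?case
      proof (rule elliptic_gamma_power_eq[OF q1 cop assms(1,2,5)])
        show "theta0 (z + of_nat k * \<tau>) (of_nat (a * b) * \<tau>) \<noteq> 0" if "k < a * b" for k
          unfolding theta0_eq_wprod[OF q1 that assms(5)] mult_eq_0_iff de_Morgan_disj
          using elim by (intro conjI wprod_nonzero admissible_if_le_Suc q1) auto
      qed (use elim in blast)
    qed
  qed
qed

end
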